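(* Let $B$ denote the closed unit ball in $\mathbb{R}^3$ centered at the origin, let $r>0$, and let $Q\subset\mathbb{R}^3$ be a convex polytope satisfying $rB\subset Q\subset B$. Then the total curvature of any shortest path on the boundary of $Q$ is less than $4\pi^2 r^{-2}$.
   Context: A shortest path on the boundary of a polytope $Q$ is a path contained in $\mathrm{bd}\,Q$, joining two points $a,b\in \mathrm{bd}\,Q$, whose length is minimal among all paths in $\mathrm{bd}\,Q$ joining $a$ and $b$; it is a polygonal path. The total curvature of a polygonal path $P=[z_0,z_1,\ldots,z_n]$ (with consecutive vertices distinct) is $$t(P)=\sum_{i=1}^{n-1}\bigl(\pi-\angle z_{i-1}z_iz_{i+1}\bigr).$$ *)

theory Defs
  imports "HOL-Analysis.Analysis"
begin

(* Jordan length: supremum over finite nondecreasing sequences of parameters.  The sequences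
   need not contain 0 and 1; adding them can only increase the sum. *)
definition path_length :: "(real \<Rightarrow> 'a::metric_space) \<Rightarrow> ereal" where
  "path_length g =
    (SUP ts \<in> {ts. sorted ts \<and> set ts \<subseteq> {0..1}}.
       ereal (\<Sum>i<length ts - 1. dist (g (ts ! i)) (g (ts ! Suc i))))"

definition shortest_path_on :: "'a::metric_space set \<Rightarrow> (real \<Rightarrow> 'a) \<Rightarrow> bool" where
  "shortest_path_on S g \<longleftrightarrow>
    path g \<and> path_image g \<subseteq> S \<and>
    (\<forall>h. path h \<and> path_image h \<subseteq> S \<and> pathstart h = pathstart g \<and> pathfinish h = pathfinish g
        \<longrightarrow> path_length g \<le> path_length h)"

fun polypath :: "'a::real_normed_vector list \<Rightarrow> real \<Rightarrow> 'a" where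
  "polypath [] = (\<lambda>_. undefined)"
| "polypath [x] = linepath x x"
| "polypath [x, y] = linepath x y"
| "polypath (x # y # z # zs) = linepath x y +++ polypath (y # z # zs)"

(* The path g is the polygonal path [z_0, ..., z_n], n >= 0, up to a change of parameter.
   The change of parameter is only weakly monotone, because g may pause. *)
definition is_polygonal_path :: "'a::real_normed_vector list \<Rightarrow> (real \<Rightarrow> 'a) \<Rightarrow> bool" where
  "is_polygonal_path zs g \<longleftrightarrow>
    zs \<noteq> [] \<and> distinct_adj zs \<and>
    (\<exists>\<phi>. continuous_on {0..1} \<phi> \<and> mono_on {0..1} \<phi> \<and> \<phi> 0 = (0::real) \<and> \<phi> 1 = 1 \<and>
         (\<forall>t\<in>{0..1}. g t = polypath zs (\<phi> t)))"

(* The angle at the middle point y. *)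
definition vertex_angle :: "'a::real_inner \<Rightarrow> 'a \<Rightarrow> 'a \<Rightarrow> real" where
  "vertex_angle x y z = arccos (((x - y) \<bullet> (z - y)) / (norm (x - y) * norm (z - y)))"

(* The vertices are zs ! 0, ..., zs ! n with n = length zs - 1. *)
definition total_curvature :: "'a::real_inner list \<Rightarrow> real" where
  "total_curvature zs =
    (\<Sum>i = 1..<length zs - 1. pi - vertex_angle (zs ! (i - 1)) (zs ! i) (zs ! Suc i))"

end

theory Submission
  imports Defs
begin

text \<open>Nearest-point projection onto \<open>Q\<close> is a contraction, so a shortest path on the boundary is also
  shortest among all paths outside the interior of \<open>Q\<close>. A detour around the unit ball bounds its length
  by 6. At a vertex \<open>z\<^sub>i\<close> with incoming and outgoing directions \<open>u\<close> and \<open>u'\<close>, moving \<open>z\<^sub>i\<close> to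
  \<open>z\<^sub>i + \<epsilon> (z\<^sub>i - q)\<close> for \<open>q \<in> Q\<close> stays outside the interior, so first variation gives
  \<open>(u - u') \<bullet> (z\<^sub>i - q) \<ge> 0\<close>. The choice of \<open>q\<close> in the sphere of radius \<open>r\<close> along \<open>u - u'\<close> yields
  \<open>r * norm (u - u') \<le> (u - u') \<bullet> z\<^sub>i\<close>. Summation by parts over all vertices bounds
  \<open>r * (\<Sum> norm (u - u'))\<close> by the length plus 2, and an exterior angle is at most twice \<open>norm (u - u')\<close>.
  The total curvature is therefore at most \<open>16 / r\<close>.\<close>

section \<open>Length of paths\<close>

text \<open>The recursive form of the sums in \<open>path_length\<close>: splitting a chain and
  inserting a point become inductions on lists.\<close>

fun chain_length :: "'a::metric_space list \<Rightarrow> real" where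
  "chain_length (x # y # zs) = dist x y + chain_length (y # zs)"
| "chain_length _ = 0"

lemma sum_dist_eq_chain_length:
  "(\<Sum>i<length xs - 1. dist (xs ! i) (xs ! Suc i)) = chain_length xs"
  by (induction xs rule: chain_length.induct) (auto simp: sum.lessThan_Suc_shift simp del: sum.lessThan_Suc)

lemma chain_length_Cons:
  "chain_length (x # xs) = (if xs = [] then 0 else dist x (hd xs) + chain_length xs)"
  by (cases xs) auto

lemma chain_length_nonneg: "0 \<le> chain_length xs"
  by (induction xs rule: chain_length.induct) auto

lemma chain_length_append:
  "chain_length (xs @ y # ys) = chain_length (xs @ [y]) + chain_length (y # ys)"
proof (induction xs)
  case (Cons x xs)
  then show ?case by (cases xs) auto
qed simp

lemma chain_length_append_ge: "chain_length xs + chain_length ys \<le> chain_length (xs @ ys)"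
proof (induction xs)
  case (Cons x xs)
  then show ?case using chain_length_nonneg[of ys]
    by (cases xs) (auto simp: chain_length_Cons)
qed simp

lemma chain_length_insert: "chain_length (xs @ ys) \<le> chain_length (xs @ y # ys)"
proof (induction xs)
  case Nil
  then show ?case by (cases ys) (auto simp: chain_length_nonneg)
next
  case (Cons x xs)
  then show ?case
    using dist_triangle[of x "hd ys" y] by (cases xs; cases ys) auto
qed

text \<open>Length over a parameter interval, so that lengths can be split at a parameter. As in
  \<open>path_length\<close>, the chains need not contain the end points, and the empty chain makes
  the supremum nonnegative.\<close>

definition length_on :: "real \<Rightarrow> real \<Rightarrow> (real \<Rightarrow> 'a::metric_space) \<Rightarrow> ereal" where
  "length_on a b g = (SUP ts \<in> {ts. sorted ts \<and> set ts \<subseteq> {a..b}}. ereal (chain_length (map g ts)))"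

lemma path_length_eq: "path_length g = length_on 0 1 g"
proof -
  have "(\<Sum>i<length ts - 1. dist (g (ts ! i)) (g (ts ! Suc i))) = chain_length (map g ts)" for ts
    unfolding sum_dist_eq_chain_length[symmetric] by (rule sum.cong) auto
  then show ?thesis by (simp add: path_length_def length_on_def)
qed

lemma chain_length_le_length_on:
  "sorted ts \<Longrightarrow> set ts \<subseteq> {a..b} \<Longrightarrow> ereal (chain_length (map g ts)) \<le> length_on a b g"
  unfolding length_on_def by (rule SUP_upper) auto

lemma length_on_least:
  assumes "\<And>ts. sorted ts \<Longrightarrow> set ts \<subseteq> {a..b} \<Longrightarrow> ereal (chain_length (map g ts)) \<le> u"
  shows "length_on a b g \<le> u"
  unfolding length_on_def using assms by (intro SUP_least) auto

lemma length_on_nonneg: "0 \<le> length_on a b g"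
  using chain_length_le_length_on[of "[]" a b g] by (simp add: zero_ereal_def)

text \<open>Chains at the same parameters are compared link by link. This is how the nearest-point
  projection shortens a path.\<close>

lemma length_on_mono:
  assumes "\<And>s t. s \<in> {a..b} \<Longrightarrow> t \<in> {a..b} \<Longrightarrow> dist (h s) (h t) \<le> dist (g s) (g t)"
  shows "length_on a b h \<le> length_on a b g"
proof (rule length_on_least)
  fix ts :: "real list"
  assume ts: "sorted ts" "set ts \<subseteq> {a..b}"
  then have "chain_length (map h ts) \<le> chain_length (map g ts)"
  proof (induction ts)
    case (Cons t ts)
    then show ?case by (cases ts) (auto intro!: add_mono assms)
  qed simp
  with chain_length_le_length_on[OF ts, of g]
  show "ereal (chain_length (map h ts)) \<le> length_on a b g"
    by (meson ereal_less_eq(3) order_trans)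
qed

lemma length_on_cong:
  assumes "\<And>t. t \<in> {a..b} \<Longrightarrow> h t = g t"
  shows "length_on a b h = length_on a b g"
  using assms by (intro antisym length_on_mono) auto

text \<open>For \<le>, a chain is cut at \<open>b\<close> after \<open>b\<close> has been inserted,
  which the triangle inequality permits. For \<ge>, chains on both sides are concatenated, and the
  extra link only adds length.\<close>

lemma length_on_combine:
  assumes "a \<le> b" "b \<le> c"
  shows "length_on a c g = length_on a b g + length_on b c g"
proof (rule antisym)
  show "length_on a c g \<le> length_on a b g + length_on b c g"
  proof (rule length_on_least)
    fix ts :: "real list"
    assume ts: "sorted ts" "set ts \<subseteq> {a..c}"
    define ls where "ls = takeWhile (\<lambda>t. t \<le> b) ts"
    define us where "us = dropWhile (\<lambda>t. t \<le> b) ts"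
    have split: "ts = ls @ us" by (simp add: ls_def us_def)
    have sorted: "sorted ls" "sorted us" using ts(1) unfolding split by (auto simp: sorted_append)
    have ls: "t \<le> b" if "t \<in> set ls" for t
      using that unfolding ls_def by (auto dest: set_takeWhileD)
    have us: "b \<le> t" if "t \<in> set us" for t
    proof (cases us)
      case (Cons u vs)
      then have "\<not> u \<le> b" unfolding us_def by (metis hd_dropWhile list.discI list.sel(1))
      with Cons sorted(2) that show ?thesis by auto
    qed (use that in simp)
    have "chain_length (map g ts) \<le> chain_length (map g ls @ g b # map g us)"
      unfolding split by (simp add: chain_length_insert)
    also have "\<dots> = chain_length (map g (ls @ [b])) + chain_length (map g (b # us))"
      by (subst chain_length_append) simp
    finally have "ereal (chain_length (map g ts)) \<le>
        ereal (chain_length (map g (ls @ [b]))) + ereal (chain_length (map g (b # us)))"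
      by simp
    also have "\<dots> \<le> length_on a b g + length_on b c g"
      using ts(2) assms sorted ls us unfolding split
      by (intro add_mono chain_length_le_length_on) (auto simp: sorted_append)
    finally show "ereal (chain_length (map g ts)) \<le> length_on a b g + length_on b c g" .
  qed
  define A where "A = {ts. sorted ts \<and> set ts \<subseteq> {a..b}}"
  define B where "B = {ts. sorted ts \<and> set ts \<subseteq> {b..c}}"
  have ne: "A \<noteq> {}" "B \<noteq> {}"
    unfolding A_def B_def by (rule ex_in_conv[THEN iffD1], rule exI[of _ "[]"], simp)+
  have "ereal (chain_length (map g ts)) + ereal (chain_length (map g us)) \<le> length_on a c g"
    if "ts \<in> A" "us \<in> B" for ts us
  proof -
    have "ereal (chain_length (map g ts)) + ereal (chain_length (map g us))
        \<le> ereal (chain_length (map g (ts @ us)))"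
      by (simp add: chain_length_append_ge)
    also have "\<dots> \<le> length_on a c g"
      using that assms unfolding A_def B_def
      by (intro chain_length_le_length_on) (fastforce simp: sorted_append)+
    finally show ?thesis .
  qed
  \<comment> \<open>The two suprema are taken one after the other. Both index sets are nonempty and
    lengths are nonnegative, so addition of extended reals commutes with the suprema.\<close>
  then have "ereal (chain_length (map g ts)) + length_on b c g \<le> length_on a c g"
    if "ts \<in> A" for ts
    using that ne unfolding length_on_def[of b c] B_def[symmetric]
    by (subst SUP_ereal_add_right[symmetric]) (auto intro!: SUP_least)
  then show "length_on a b g + length_on b c g \<le> length_on a c g"
    using ne length_on_nonneg[of b c g] unfolding length_on_def[of a b] A_def[symmetric]
    by (subst SUP_ereal_add_left[symmetric]) (auto intro!: SUP_least)
qed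

lemma length_on_compose_le:
  assumes "mono_on {a..b} \<phi>"
  shows "length_on a b (g \<circ> \<phi>) \<le> length_on (\<phi> a) (\<phi> b) g"
proof (rule length_on_least)
  fix ts :: "real list"
  assume ts: "sorted ts" "set ts \<subseteq> {a..b}"
  have "sorted (map \<phi> ts)"
    using ts assms unfolding sorted_map
    by (auto elim!: sorted_wrt_mono_rel[rotated] simp: mono_on_def subset_iff)
  moreover have "set (map \<phi> ts) \<subseteq> {\<phi> a..\<phi> b}"
    using ts(2) assms by (fastforce simp: mono_on_def)
  ultimately show "ereal (chain_length (map (g \<circ> \<phi>) ts)) \<le> length_on (\<phi> a) (\<phi> b) g"
    using chain_length_le_length_on[of "map \<phi> ts" "\<phi> a" "\<phi> b" g] by simp
qed

text \<open>A weakly monotone \<open>\<phi>\<close> may have no inverse, but the intermediate value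
  theorem gives a right inverse \<open>\<psi>\<close>, and any such \<open>\<psi>\<close> is
  monotone. Composition with a monotone map does not increase length, so both inequalities
  follow.\<close>

lemma length_on_reparam:
  assumes "a \<le> b" "continuous_on {a..b} \<phi>" "mono_on {a..b} \<phi>"
  shows "length_on a b (g \<circ> \<phi>) = length_on (\<phi> a) (\<phi> b) g"
proof (rule antisym)
  have "\<exists>s\<in>{a..b}. \<phi> s = t" if "t \<in> {\<phi> a..\<phi> b}" for t
    using IVT'[of \<phi> a t b] that assms by auto
  then obtain \<psi> where \<psi>: "\<And>t. t \<in> {\<phi> a..\<phi> b} \<Longrightarrow> \<psi> t \<in> {a..b} \<and> \<phi> (\<psi> t) = t"
    by metis
  have "mono_on {\<phi> a..\<phi> b} \<psi>"
  proof (rule mono_onI)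
    fix s t
    assume st: "s \<in> {\<phi> a..\<phi> b}" "t \<in> {\<phi> a..\<phi> b}" "s \<le> t"
    show "\<psi> s \<le> \<psi> t"
    proof (rule ccontr)
      assume "\<not> \<psi> s \<le> \<psi> t"
      then have "\<phi> (\<psi> t) \<le> \<phi> (\<psi> s)"
        using \<psi>[OF st(1)] \<psi>[OF st(2)] by (intro mono_onD[OF assms(3)]) auto
      then have "s = t" using \<psi>[OF st(1)] \<psi>[OF st(2)] st(3) by simp
      with \<open>\<not> \<psi> s \<le> \<psi> t\<close> show False by simp
    qed
  qed
  then have "length_on (\<phi> a) (\<phi> b) (g \<circ> \<phi> \<circ> \<psi>) \<le> length_on (\<psi> (\<phi> a)) (\<psi> (\<phi> b)) (g \<circ> \<phi>)"
    by (rule length_on_compose_le)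
  \<comment> \<open>\<open>\<psi>\<close> may choose a parameter strictly inside
    \<open>{a..b}\<close> even for the end values, so this is only an inclusion of
    intervals.\<close>
  also have "\<dots> \<le> length_on a b (g \<circ> \<phi>)"
  proof -
    have "\<phi> a \<le> \<phi> b" using assms by (simp add: mono_on_def)
    then have "a \<le> \<psi> (\<phi> a)" "\<psi> (\<phi> b) \<le> b" using \<psi> by auto
    then show ?thesis
      unfolding length_on_def by (intro SUP_subset_mono) auto
  qed
  also have "length_on (\<phi> a) (\<phi> b) (g \<circ> \<phi> \<circ> \<psi>) = length_on (\<phi> a) (\<phi> b) g"
    by (intro length_on_cong) (simp add: \<psi>)
  finally show "length_on (\<phi> a) (\<phi> b) g \<le> length_on a b (g \<circ> \<phi>)" .
qed (rule length_on_compose_le[OF assms(3)])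

lemma path_length_join:
  assumes "pathfinish f = pathstart g"
  shows "path_length (f +++ g) = path_length f + path_length g"
proof -
  have "length_on 0 (1/2) (f +++ g) = length_on 0 (1/2) (f \<circ> (\<lambda>t. 2 * t))"
    by (intro length_on_cong) (auto simp: joinpaths_def)
  also have "\<dots> = path_length f"
    by (subst length_on_reparam)
      (auto simp: path_length_eq intro!: continuous_intros mono_onI)
  finally have 1: "length_on 0 (1/2) (f +++ g) = path_length f" .
  have "length_on (1/2) 1 (f +++ g) = length_on (1/2) 1 (g \<circ> (\<lambda>t. 2 * t - 1))"
  proof (rule length_on_cong)
    fix t :: real
    assume "t \<in> {1/2..1}"
    then show "(f +++ g) t = (g \<circ> (\<lambda>t. 2 * t - 1)) t"
    \<comment> \<open>At \<open>1/2\<close> the joined path still follows \<open>f\<close>; here the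
      matching end points enter.\<close>
    proof (cases "t = 1/2")
      case True
      show ?thesis
        unfolding True using assms by (simp add: joinpaths_def pathstart_def pathfinish_def)
    qed (auto simp: joinpaths_def)
  qed
  also have "\<dots> = path_length g"
    by (subst length_on_reparam)
      (auto simp: path_length_eq intro!: continuous_intros mono_onI)
  finally have 2: "length_on (1/2) 1 (f +++ g) = path_length g" .
  from 1 2 show ?thesis
    unfolding path_length_eq[of "f +++ g"] by (subst length_on_combine[of 0 "1/2"]) auto
qed

text \<open>Along a straight segment the links are proportional to the parameter differences, which
  telescope.\<close>

lemma chain_length_linear:
  fixes x y :: "'a::real_normed_vector"
  assumes "sorted (t # ts)"
  shows "chain_length (map (\<lambda>t. (1 - t) *\<^sub>R x + t *\<^sub>R y) (t # ts)) = (last (t # ts) - t) * dist x y"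
  using assms
proof (induction ts arbitrary: t)
  case (Cons u us)
  have "((1 - t) *\<^sub>R x + t *\<^sub>R y) - ((1 - u) *\<^sub>R x + u *\<^sub>R y) = (u - t) *\<^sub>R (x - y)"
    by (simp add: algebra_simps)
  then have "dist ((1 - t) *\<^sub>R x + t *\<^sub>R y) ((1 - u) *\<^sub>R x + u *\<^sub>R y) = (u - t) * dist x y"
    using Cons.prems by (simp add: dist_norm)
  with Cons.IH[of u] Cons.prems show ?case by (simp add: algebra_simps)
qed simp

lemma path_length_linepath: "path_length (linepath x y) = dist x y"
  unfolding path_length_eq
proof (rule antisym)
  show "length_on 0 1 (linepath x y) \<le> ereal (dist x y)"
  proof (rule length_on_least)
    fix ts :: "real list"
    assume ts: "sorted ts" "set ts \<subseteq> {0..1}"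
    show "ereal (chain_length (map (linepath x y) ts)) \<le> ereal (dist x y)"
    proof (cases ts)
      case (Cons u us)
      have "last ts - u \<le> 1"
        using subsetD[OF ts(2) last_in_set] subsetD[OF ts(2), of u] Cons by auto
      then have "(last ts - u) * dist x y \<le> 1 * dist x y"
        by (intro mult_right_mono) auto
      then show ?thesis
        using chain_length_linear[of u us x y] ts(1) Cons by (simp add: linepath_def)
    qed simp
  qed
  show "ereal (dist x y) \<le> length_on 0 1 (linepath x y)"
    using chain_length_le_length_on[of "[0, 1]" 0 1 "linepath x y"] by (simp add: linepath_def)
qed

section \<open>Polygonal paths and projection\<close>

lemma polypath_path:
  assumes "zs \<noteq> []"
  shows "path (polypath zs) \<and> pathstart (polypath zs) = hd zs \<and> pathfinish (polypath zs) = last zs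
    \<and> path_length (polypath zs) = chain_length zs"
  using assms
proof (induction zs rule: polypath.induct)
  case (4 x y z zs)
  then show ?case by (simp add: path_length_join path_length_linepath)
qed (simp_all add: path_length_linepath zero_ereal_def)

text \<open>The condition on \<open>hd zs\<close> covers the one-vertex list, for which
  \<open>successively\<close> is vacuous.\<close>

lemma path_image_polypath_subset_iff:
  assumes "zs \<noteq> []"
  shows "path_image (polypath zs) \<subseteq> S \<longleftrightarrow>
    hd zs \<in> S \<and> successively (\<lambda>x y. closed_segment x y \<subseteq> S) zs"
  using assms
proof (induction zs rule: polypath.induct)
  case (4 x y z zs)
  have "path_image (linepath x y +++ polypath (y # z # zs)) =
      closed_segment x y \<union> path_image (polypath (y # z # zs))"
    using polypath_path[of "y # z # zs"] by (subst path_image_join) auto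
  then show ?case
    using 4 ends_in_segment[of x y] by auto
qed auto

lemma polygonal_path_props:
  assumes "is_polygonal_path zs g"
  shows "path_length g = chain_length zs" "path_image g = path_image (polypath zs)"
    "pathstart g = hd zs" "pathfinish g = last zs"
proof -
  from assms obtain \<phi> where ne: "zs \<noteq> []"
    and \<phi>: "continuous_on {0..1} \<phi>" "mono_on {0..1} \<phi>" "\<phi> 0 = (0::real)" "\<phi> 1 = 1"
      "\<And>t. t \<in> {0..1} \<Longrightarrow> g t = polypath zs (\<phi> t)"
    unfolding is_polygonal_path_def by auto
  note p = polypath_path[OF ne]
  have "path_length g = length_on 0 1 (polypath zs \<circ> \<phi>)"
    unfolding path_length_eq by (rule length_on_cong) (simp add: \<phi>(5))
  also have "\<dots> = chain_length zs"
    using length_on_reparam[OF _ \<phi>(1,2), of "polypath zs"] \<phi>(3,4) p by (simp add: path_length_eq)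
  finally show "path_length g = chain_length zs" .
  \<comment> \<open>The pauses of \<open>g\<close> do not matter for its image, since
    \<open>\<phi>\<close> is onto by the intermediate value theorem.\<close>
  have "\<phi> ` {0..1} = {0..1}"
  proof
    show "\<phi> ` {0..1} \<subseteq> {0..1}"
      using mono_onD[OF \<phi>(2), of 0] mono_onD[OF \<phi>(2), of _ 1] \<phi>(3,4) by fastforce
    show "{0..1} \<subseteq> \<phi> ` {0..1}"
      using IVT'[of \<phi> 0 _ 1] \<phi>(1,3,4) by fastforce
  qed
  then show "path_image g = path_image (polypath zs)"
    unfolding path_image_def using \<phi>(5) by (metis (no_types, lifting) image_cong image_image)
  show "pathstart g = hd zs" "pathfinish g = last zs"
    using p \<phi>(3-5) by (auto simp: pathstart_def pathfinish_def)
qed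

text \<open>The nearest-point projection does not increase lengths and maps the complement of the interior
  into the boundary, so leaving the body is of no use.\<close>
lemma shortest_frontier_path_le_outside:
  fixes Q :: "'a::euclidean_space set"
  assumes Q: "convex Q" "closed Q" "interior Q \<noteq> {}"
    and g: "shortest_path_on (frontier Q) g"
    and h: "path h" "path_image h \<inter> interior Q = {}"
      "pathstart h = pathstart g" "pathfinish h = pathfinish g"
  shows "path_length g \<le> path_length h"
proof -
  have ne: "Q \<noteq> {}" using Q(3) interior_subset by blast
  let ?h = "closest_point Q \<circ> h"
  have fr: "frontier Q \<subseteq> Q" by (simp add: frontier_subset_closed Q(2))
  have "path ?h"
    using h(1) continuous_on_closest_point[OF Q(1,2) ne] unfolding path_def
    by (intro continuous_on_compose) auto
  moreover have "path_image ?h \<subseteq> frontier Q"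
  proof -
    \<comment> \<open>As \<open>Q\<close> has interior points, its affine hull is the whole space,
      and its relative frontier is the ordinary one.\<close>
    have "closest_point Q x \<in> frontier Q" if "x \<notin> interior Q" for x
      using closest_point_in_rel_frontier[OF Q(2) ne, of x] that Q(3)
      by (simp add: affine_hull_nonempty_interior rel_interior_nonempty_interior
          rel_frontier_nonempty_interior)
    then show ?thesis using h(2) by (auto simp: path_image_def)
  qed
  moreover have "pathstart g \<in> Q" "pathfinish g \<in> Q"
    using g fr unfolding shortest_path_on_def
    by (meson pathstart_in_path_image pathfinish_in_path_image subsetD)+
  then have "pathstart ?h = pathstart g" "pathfinish ?h = pathfinish g"
    using h(3,4) by (simp_all add: pathstart_compose pathfinish_compose closest_point_self)
  ultimately have "path_length g \<le> path_length ?h"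
    using g unfolding shortest_path_on_def by blast
  also have "\<dots> \<le> path_length h"
    unfolding path_length_eq by (intro length_on_mono) (simp add: closest_point_lipschitz Q ne)
  finally show ?thesis .
qed

text \<open>The form in which minimality is used below: a competitor is just a list of points whose
  segments avoid the interior.\<close>

lemma shortest_frontier_path_le_chain:
  fixes Q :: "'a::euclidean_space set"
  assumes Q: "convex Q" "closed Q" "interior Q \<noteq> {}"
    and g: "shortest_path_on (frontier Q) g"
    and zs: "zs \<noteq> []" "hd zs = pathstart g" "last zs = pathfinish g"
      "successively (\<lambda>x y. closed_segment x y \<subseteq> - interior Q) zs"
  shows "path_length g \<le> chain_length zs"
proof -
  have "pathstart g \<in> frontier Q"
    using g unfolding shortest_path_on_def by (meson pathstart_in_path_image subsetD)
  then have "path_image (polypath zs) \<subseteq> - interior Q"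
    using zs by (subst path_image_polypath_subset_iff) (auto simp: frontier_def)
  then show ?thesis
    using shortest_frontier_path_le_outside[OF Q g, of "polypath zs"] polypath_path[OF zs(1)] zs
    by auto
qed

text \<open>The witness is \<open>sgn a\<close>. Since \<open>norm a \<le> 1\<close>, the segment
  runs outwards on the ray of \<open>a\<close>, so its points are multiples of \<open>a\<close> by
  factors at least 1.\<close>

lemma segment_to_unit_vector:
  fixes a :: "'a::real_inner"
  assumes "0 < r" "r \<le> norm a" "norm a \<le> 1"
  shows "\<exists>p. norm p = 1 \<and> dist a p \<le> 1 \<and> (\<forall>x\<in>closed_segment a p. \<exists>t\<ge>1. x = t *\<^sub>R a)"
proof (rule exI[of _ "sgn a"], intro conjI ballI)
  have a: "a \<noteq> 0" using assms by auto
  show "norm (sgn a) = 1" using a by (simp add: norm_sgn)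
  have "a - sgn a = (1 - inverse (norm a)) *\<^sub>R a" by (simp add: sgn_div_norm algebra_simps)
  also have "norm \<dots> = \<bar>(1 - inverse (norm a)) * norm a\<bar>" by (simp add: abs_mult)
  also have "(1 - inverse (norm a)) * norm a = norm a - 1" using a by (simp add: left_diff_distrib)
  also have "\<bar>norm a - 1\<bar> \<le> 1" using assms by simp
  finally show "dist a (sgn a) \<le> 1" by (simp add: dist_norm)
  fix x
  assume "x \<in> closed_segment a (sgn a)"
  then obtain u where u: "0 \<le> u" "u \<le> 1" "x = (1 - u) *\<^sub>R a + u *\<^sub>R sgn a"
    by (auto simp: in_segment)
  have "x = (1 + u * (inverse (norm a) - 1)) *\<^sub>R a"
    unfolding u(3) sgn_div_norm by (simp add: algebra_simps)
  moreover have "1 \<le> inverse (norm a)" using assms a by (simp add: one_le_inverse)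
  then have "1 \<le> 1 + u * (inverse (norm a) - 1)" using u(1) by simp
  ultimately show "\<exists>t\<ge>1. x = t *\<^sub>R a" by blast
qed

section \<open>Variation of a shortest path\<close>

lemma cball_subset_imp_interior_nonempty:
  assumes "0 < r" "cball x r \<subseteq> Q"
  shows "interior Q \<noteq> {}"
  using interior_maximal[OF order_trans[OF ball_subset_cball assms(2)]] assms(1) by auto

text \<open>The interior of a closed half-space is the open half-space. Hence a point on or beyond a
  supporting hyperplane is not interior.\<close>

lemma interior_inner_less:
  fixes n :: "'a::euclidean_space"
  assumes "n \<noteq> 0" "\<And>q. q \<in> Q \<Longrightarrow> n \<bullet> q \<le> b" "x \<in> interior Q"
  shows "n \<bullet> x < b"
proof -
  have "interior Q \<subseteq> interior {x. n \<bullet> x \<le> b}" using assms(2) by (intro interior_mono) auto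
  then show ?thesis using assms(1,3) by auto
qed

lemma supporting_hyperplane_frontier:
  fixes Q :: "'a::euclidean_space set"
  assumes "convex Q" "interior Q \<noteq> {}" "x \<in> frontier Q"
  obtains n where "n \<noteq> 0" "\<And>q. q \<in> Q \<Longrightarrow> n \<bullet> q \<le> n \<bullet> x"
proof -
  have "x \<in> closure Q" "x \<notin> rel_interior Q"
    using assms by (auto simp: frontier_def rel_interior_nonempty_interior)
  then obtain a where "a \<noteq> 0" "\<And>y. y \<in> closure Q \<Longrightarrow> a \<bullet> x \<le> a \<bullet> y"
    using supporting_hyperplane_relative_frontier[OF assms(1)] by metis
  then show ?thesis using that[of "- a"] closure_subset[of Q] by auto
qed

text \<open>Take a supporting hyperplane at the midpoint. The linear functional \<open>n\<close>
  attains its maximum over \<open>Q\<close> there, in the middle of the segment, hence is constant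
  on the segment.\<close>

lemma supporting_hyperplane_frontier_segment:
  fixes Q :: "'a::euclidean_space set"
  assumes Q: "convex Q" "closed Q" "interior Q \<noteq> {}" and xy: "closed_segment x y \<subseteq> frontier Q"
  obtains n where "n \<noteq> 0" "n \<bullet> x = n \<bullet> y" "\<And>q. q \<in> Q \<Longrightarrow> n \<bullet> q \<le> n \<bullet> y"
proof -
  have "midpoint x y \<in> frontier Q" using xy by auto
  then obtain n where n: "n \<noteq> 0" "\<And>q. q \<in> Q \<Longrightarrow> n \<bullet> q \<le> n \<bullet> midpoint x y"
    using supporting_hyperplane_frontier[OF Q(1,3)] by metis
  have "x \<in> Q" "y \<in> Q"
    using xy frontier_subset_closed[OF Q(2)] by auto
  then have le: "n \<bullet> x \<le> n \<bullet> midpoint x y" "n \<bullet> y \<le> n \<bullet> midpoint x y" using n by auto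
  have "n \<bullet> midpoint x y = (n \<bullet> x + n \<bullet> y) / 2"
    by (simp add: midpoint_def inner_add_right inner_diff_right)
  with le n show ?thesis by (intro that[of n]) auto
qed

text \<open>A detour over the sphere: move \<open>a\<close> and \<open>b\<close> radially to unit vectors \<open>p\<close> and \<open>q\<close>, and join
  these through \<open>p + e\<close> and \<open>q + e\<close> with a unit vector \<open>e\<close> orthogonal to \<open>p\<close>, turned so that
  \<open>q \<bullet> e \<ge> 0\<close>. The three inner pieces avoid the open unit ball.\<close>
lemma shortest_frontier_path_length_le:
  fixes Q :: "'a::euclidean_space set"
  assumes dim: "2 \<le> DIM('a)" and Q: "convex Q" "closed Q"
    and r: "0 < r" "cball 0 r \<subseteq> Q" "Q \<subseteq> cball 0 1"
    and g: "shortest_path_on (frontier Q) g"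
  shows "path_length g \<le> 6"
proof -
  have ball: "ball 0 r \<subseteq> interior Q" using r(2) by (simp add: interior_maximal order_trans[OF ball_subset_cball])
  then have ne: "interior Q \<noteq> {}" using r(1) by auto
  have int1: "norm x < 1" if "x \<in> interior Q" for x
  proof -
    have "interior Q \<subseteq> interior (cball 0 1)" using r(3) by (rule interior_mono)
    then show ?thesis using that by auto
  qed
  define a where "a = pathstart g"
  define b where "b = pathfinish g"
  have ab: "a \<in> frontier Q" "b \<in> frontier Q"
    using g unfolding shortest_path_on_def a_def b_def
    by (meson pathstart_in_path_image pathfinish_in_path_image subsetD)+
  have radial: "\<exists>p. norm p = 1 \<and> dist c p \<le> 1 \<and> closed_segment c p \<subseteq> - interior Q"
    if c: "c \<in> frontier Q" for c
  proof -
    have "c \<notin> interior Q" "c \<in> Q"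
      using c frontier_subset_closed[OF Q(2)] by (auto simp: frontier_def)
    then have "c \<notin> ball 0 r" "c \<in> cball 0 1" using ball r(3) by blast+
    then have "r \<le> norm c" "norm c \<le> 1" by auto
    then obtain p where p: "norm p = 1" "dist c p \<le> 1"
      "\<And>x. x \<in> closed_segment c p \<Longrightarrow> \<exists>t\<ge>1. x = t *\<^sub>R c"
      using segment_to_unit_vector[OF r(1)] by meson
    obtain n where n: "n \<noteq> 0" "\<And>q. q \<in> Q \<Longrightarrow> n \<bullet> q \<le> n \<bullet> c"
      using supporting_hyperplane_frontier[OF Q(1) ne c] by metis
    \<comment> \<open>Because the origin lies in \<open>Q\<close>, the value
      \<open>n \<bullet> c\<close> is nonnegative, so going outwards on the ray of \<open>c\<close>
      never crosses back over the hyperplane.\<close>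
    have "0 \<in> Q" using r by auto
    then have "0 \<le> n \<bullet> c" using n(2)[of 0] by simp
    then have "n \<bullet> c \<le> n \<bullet> (t *\<^sub>R c)" if "1 \<le> t" for t
      using that mult_right_mono[of 1 t "n \<bullet> c"] by simp
    then have "t *\<^sub>R c \<notin> interior Q" if "1 \<le> t" for t
      using that interior_inner_less[OF n] by (meson not_le)
    then show ?thesis using p by blast
  qed
  obtain p where p: "norm p = 1" "dist a p \<le> 1" "closed_segment a p \<subseteq> - interior Q"
    using radial ab by blast
  obtain q where q: "norm q = 1" "dist b q \<le> 1" "closed_segment b q \<subseteq> - interior Q"
    using radial ab by blast
  obtain y where y: "y \<noteq> 0" "orthogonal p y" using orthogonal_to_vector_exists[OF dim] by metis
  define e where "e = (if 0 \<le> q \<bullet> y then sgn y else - sgn y)"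
  have e: "norm e = 1" "p \<bullet> e = 0" "0 \<le> q \<bullet> e"
    using y by (auto simp: e_def norm_sgn orthogonal_def sgn_div_norm zero_le_mult_iff
        mult_le_0_iff)
  have up: "closed_segment c (c + e) \<subseteq> - interior Q" if c: "norm c = 1" "0 \<le> c \<bullet> e" for c
  proof
    fix x
    assume "x \<in> closed_segment c (c + e)"
    then obtain t where t: "0 \<le> t" "x = c + t *\<^sub>R e"
      by (auto simp: in_segment algebra_simps)
    have "(norm x)\<^sup>2 = 1 + 2 * t * (c \<bullet> e) + t\<^sup>2"
      unfolding t(2) power2_norm_eq_inner using c(1) e(1)
      by (simp add: inner_add inner_commute norm_eq_1 power2_eq_square algebra_simps)
    then have "1 \<le> (norm x)\<^sup>2" using t(1) c(2) by simp
    then have "1 \<le> norm x" using power_less_one_iff[of "norm x" 2] by fastforce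
    then show "x \<in> - interior Q" using int1[of x] by auto
  qed
  have across: "closed_segment (p + e) (q + e) \<subseteq> - interior Q"
  proof
    fix x
    assume "x \<in> closed_segment (p + e) (q + e)"
    then obtain t where t: "0 \<le> t" "x = (1 - t) *\<^sub>R (p + e) + t *\<^sub>R (q + e)"
      by (auto simp: in_segment)
    \<comment> \<open>The whole segment lies on or beyond the hyperplane that touches the unit ball
      at \<open>e\<close>.\<close>
    have "x \<bullet> e = 1 + t * (q \<bullet> e)"
      unfolding t(2) using e by (simp add: inner_add inner_diff norm_eq_1 algebra_simps)
    then have "1 \<le> x \<bullet> e" using t(1) e(3) by simp
    then have "1 \<le> norm x" using norm_cauchy_schwarz[of x e] e(1) by simp
    then show "x \<in> - interior Q" using int1[of x] by auto
  qed
  have "path_length g \<le> chain_length [a, p, p + e, q + e, q, b]"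
    using up[of p] up[of q] across p q e
    by (intro shortest_frontier_path_le_chain[OF Q ne g])
      (auto simp: a_def b_def closed_segment_commute)
  \<comment> \<open>The radial pieces and the pieces along \<open>e\<close> contribute at most 1
    each, the piece across at most 2.\<close>
  also have "chain_length [a, p, p + e, q + e, q, b] \<le> 6"
  proof -
    have "dist (p + e) (q + e) \<le> 2"
      using norm_triangle_ineq4[of p q] p(1) q(1) by (simp add: dist_norm)
    then show ?thesis using p(2) q(2) e(1) by (simp add: dist_norm norm_minus_commute)
  qed
  finally show ?thesis by simp
qed

section \<open>First variation of length\<close>

text \<open>A second-order upper bound without limits: estimate
  \<open>2 * norm a * norm (a + \<epsilon> *\<^sub>R v)\<close> by the sum of the two squares,
  expand, and divide by \<open>2 * norm a\<close>.\<close>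

lemma norm_add_scaleR_le:
  fixes a v :: "'a::real_inner"
  assumes "a \<noteq> 0"
  shows "norm (a + \<epsilon> *\<^sub>R v) \<le> norm a + \<epsilon> * (sgn a \<bullet> v) + \<epsilon>\<^sup>2 * ((norm v)\<^sup>2 / (2 * norm a))"
proof -
  let ?n = "norm a" and ?m = "norm (a + \<epsilon> *\<^sub>R v)"
  have n: "?n > 0" using assms by simp
  have "2 * ?n * ?m \<le> ?n\<^sup>2 + ?m\<^sup>2" by (simp add: sum_squares_bound)
  also have "?m\<^sup>2 = ?n\<^sup>2 + 2 * \<epsilon> * (a \<bullet> v) + \<epsilon>\<^sup>2 * (norm v)\<^sup>2"
    unfolding power2_norm_eq_inner
    by (simp add: inner_add inner_commute power2_eq_square algebra_simps)
  finally have "?m \<le> (2 * ?n\<^sup>2 + 2 * \<epsilon> * (a \<bullet> v) + \<epsilon>\<^sup>2 * (norm v)\<^sup>2) / (2 * ?n)"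
    using n by (simp add: field_simps)
  also have "\<dots> = ?n + \<epsilon> * (sgn a \<bullet> v) + \<epsilon>\<^sup>2 * ((norm v)\<^sup>2 / (2 * ?n))"
    using n by (simp add: sgn_div_norm field_simps power2_eq_square)
  finally show ?thesis .
qed

text \<open>First variation: moving \<open>y\<close> away from a point \<open>q\<close> of \<open>Q\<close> keeps both segments outside the
  interior, because the supporting hyperplanes containing them do not separate \<open>y\<close> from \<open>y - q\<close>.\<close>
lemma first_variation_frontier:
  fixes Q :: "'a::euclidean_space set"
  assumes Q: "convex Q" "closed Q" "interior Q \<noteq> {}"
    and xyz: "x \<noteq> y" "y \<noteq> z" "closed_segment x y \<subseteq> frontier Q" "closed_segment y z \<subseteq> frontier Q"
    and min: "\<And>y'. closed_segment x y' \<subseteq> - interior Q \<Longrightarrow> closed_segment y' z \<subseteq> - interior Q \<Longrightarrow>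
      dist x y + dist y z \<le> dist x y' + dist y' z"
    and q: "q \<in> Q"
  shows "0 \<le> (sgn (y - x) - sgn (z - y)) \<bullet> (y - q)"
proof (rule ccontr)
  let ?v = "y - q"
  \<comment> \<open>\<open>W\<close> is the derivative at 0 of the length of the two edges when
    \<open>y\<close> moves with velocity \<open>y - q\<close>; \<open>C\<close> below is the
    coefficient of the quadratic error.\<close>
  define W where "W = sgn (y - x) \<bullet> ?v + sgn (y - z) \<bullet> ?v"
  have "sgn (z - y) = - sgn (y - z)" using sgn_minus[of "y - z"] by simp
  then have W: "W = (sgn (y - x) - sgn (z - y)) \<bullet> ?v"
    by (simp add: W_def inner_add_left)
  assume "\<not> 0 \<le> (sgn (y - x) - sgn (z - y)) \<bullet> (y - q)"
  then have neg: "W < 0" using W by simp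
  define C where "C = (norm ?v)\<^sup>2 / (2 * norm (y - x)) + (norm ?v)\<^sup>2 / (2 * norm (y - z))"
  have C: "0 \<le> C" by (simp add: C_def)
  \<comment> \<open>With this choice \<open>W + \<epsilon> * C\<close> equals
    \<open>W / (C + 1)\<close>, which is still negative, so the move would shorten the path.\<close>
  define \<epsilon> where "\<epsilon> = - W / (C + 1)"
  have \<epsilon>: "0 < \<epsilon>" using neg C by (simp add: \<epsilon>_def divide_neg_pos)
  have avoid: "closed_segment w (y + \<epsilon> *\<^sub>R ?v) \<subseteq> - interior Q"
    if w: "closed_segment w y \<subseteq> frontier Q" for w
  proof
    obtain n where n: "n \<noteq> 0" "n \<bullet> w = n \<bullet> y" "\<And>q. q \<in> Q \<Longrightarrow> n \<bullet> q \<le> n \<bullet> y"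
      using supporting_hyperplane_frontier_segment[OF Q w] by metis
    fix u
    assume "u \<in> closed_segment w (y + \<epsilon> *\<^sub>R ?v)"
    then obtain t where t: "0 \<le> t" "u = (1 - t) *\<^sub>R w + t *\<^sub>R (y + \<epsilon> *\<^sub>R ?v)"
      by (auto simp: in_segment)
    have "n \<bullet> u = n \<bullet> y + t * (\<epsilon> * (n \<bullet> ?v))"
      unfolding t(2) using n(2) by (simp add: inner_add_right inner_diff_right algebra_simps)
    moreover have "0 \<le> n \<bullet> ?v" using n(3)[OF q] by (simp add: inner_diff_right)
    ultimately have "n \<bullet> y \<le> n \<bullet> u" using t(1) \<epsilon> by simp
    then show "u \<in> - interior Q"
      using interior_inner_less[OF n(1,3), where x = u] by auto
  qed
  have "dist x y + dist y z \<le> dist x (y + \<epsilon> *\<^sub>R ?v) + dist (y + \<epsilon> *\<^sub>R ?v) z"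
    using xyz avoid[of x] avoid[of z]
    by (intro min) (simp_all add: closed_segment_commute)
  also have "\<dots> = norm ((y - x) + \<epsilon> *\<^sub>R ?v) + norm ((y - z) + \<epsilon> *\<^sub>R ?v)"
  proof -
    have "dist x (y + w) = norm ((y - x) + w)" "dist (y + w) z = norm ((y - z) + w)" for w
      using norm_minus_commute[of x "y + w"] by (simp_all add: dist_norm diff_add_eq)
    then show ?thesis by simp
  qed
  also have "\<dots> \<le> norm (y - x) + norm (y - z) + (\<epsilon> * W + \<epsilon>\<^sup>2 * C)"
  proof -
    have "y - x \<noteq> 0" "y - z \<noteq> 0" using xyz(1,2) by auto
    from this[THEN norm_add_scaleR_le, of \<epsilon> ?v] show ?thesis
      unfolding W_def C_def distrib_left by linarith
  qed
  finally have "0 \<le> \<epsilon> * W + \<epsilon>\<^sup>2 * C"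
    using dist_norm[of y x] dist_norm[of y z] dist_commute[of x y] by linarith
  then have "0 \<le> \<epsilon> * (W + \<epsilon> * C)"
    by (simp add: power2_eq_square distrib_left mult.assoc)
  then have "0 \<le> W + \<epsilon> * C" using \<epsilon> by (simp add: zero_le_mult_iff)
  moreover have "W + \<epsilon> * C = W / (C + 1)" using C by (simp add: \<epsilon>_def field_simps)
  moreover have "W / (C + 1) < 0" using neg C by (simp add: divide_neg_pos)
  ultimately show False by simp
qed

section \<open>Exterior angles and chords of the unit sphere\<close>

text \<open>With \<open>x = y / 2\<close>, the double angle formula and
  \<open>x * cos x \<le> sin x\<close> give \<open>2 * x * (cos x)\<^sup>2 \<le> sin y\<close>, and
  \<open>(cos x)\<^sup>2\<close> is at least 1/2 because \<open>x \<le> pi / 4\<close>.\<close>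

lemma sin_ge_half:
  assumes "0 \<le> y" "y \<le> pi / 2"
  shows "y / 2 \<le> sin y"
proof -
  let ?x = "y / 2"
  have x: "0 \<le> ?x" "?x \<le> pi / 4" using assms by auto
  \<comment> \<open>The function \<open>sin t - t * cos t\<close> vanishes at 0 and has derivative
    \<open>t * sin t\<close>, which is nonnegative here.\<close>
  have "sin 0 - 0 * cos 0 \<le> sin ?x - ?x * cos ?x"
  proof (rule DERIV_nonneg_imp_nondecreasing[OF x(1)])
    fix t :: real
    assume t: "0 \<le> t" "t \<le> ?x"
    have "((\<lambda>t. sin t - t * cos t) has_real_derivative t * sin t) (at t)"
      by (auto intro!: derivative_eq_intros)
    moreover have "0 \<le> t * sin t" using t x pi_gt_zero by (intro mult_nonneg_nonneg sin_ge_zero) linarith+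
    ultimately show "\<exists>d. ((\<lambda>t. sin t - t * cos t) has_real_derivative d) (at t) \<and> 0 \<le> d" by blast
  qed
  then have 1: "?x * cos ?x \<le> sin ?x" by simp
  have "cos (pi / 4) \<le> cos ?x" using x pi_gt_zero by (intro cos_monotone_0_pi_le) linarith+
  then have 2: "sqrt 2 / 2 \<le> cos ?x" by (simp add: cos_45)
  have "(sqrt 2 / 2)\<^sup>2 \<le> (cos ?x)\<^sup>2" using 2 by (intro power_mono) auto
  then have 3: "1 / 2 \<le> cos ?x * cos ?x" by (simp add: power2_eq_square)
  have "y / 2 = 2 * ?x * (1 / 2)" by simp
  also have "\<dots> \<le> 2 * ?x * (cos ?x * cos ?x)" using 3 x(1) by (intro mult_left_mono) auto
  also have "\<dots> = 2 * (?x * cos ?x) * cos ?x" by simp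
  also have "\<dots> \<le> 2 * sin ?x * cos ?x"
    using 1 order_trans[OF _ 2, of 0] by (intro mult_right_mono mult_left_mono) auto
  also have "\<dots> = sin y" using sin_double[of ?x] by simp
  finally show ?thesis .
qed

text \<open>Unit vectors at angle \<open>\<theta>\<close> have distance
  \<open>2 * sin (\<theta> / 2)\<close>; \<open>sin_ge_half\<close> at \<open>\<theta> / 2\<close>
  gives the factor 2.\<close>

lemma arccos_inner_le:
  fixes u v :: "'a::real_inner"
  assumes "norm u = 1" "norm v = 1"
  shows "arccos (u \<bullet> v) \<le> 2 * norm (u - v)"
proof -
  have "\<bar>u \<bullet> v\<bar> \<le> 1" using Cauchy_Schwarz_ineq2[of u v] assms by simp
  then have c: "- 1 \<le> u \<bullet> v" "u \<bullet> v \<le> 1" by auto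
  let ?y = "arccos (u \<bullet> v) / 2"
  have y: "0 \<le> ?y" "?y \<le> pi / 2" using arccos_bounded[OF c] by auto
  have "(norm (u - v))\<^sup>2 = 2 - 2 * (u \<bullet> v)"
    using assms unfolding power2_norm_eq_inner
    by (simp add: inner_diff inner_commute norm_eq_1)
  also have "u \<bullet> v = cos (2 * ?y)" using c by (simp add: cos_arccos)
  also have "2 - 2 * cos (2 * ?y) = (2 * sin ?y)\<^sup>2"
    unfolding cos_double_sin by (simp add: power2_eq_square)
  finally have sq: "(norm (u - v))\<^sup>2 = (2 * sin ?y)\<^sup>2" .
  have "0 \<le> 2 * sin ?y" using sin_ge_half[OF y] y(1) by linarith
  then have "norm (u - v) = 2 * sin ?y" by (rule power2_eq_imp_eq[OF sq norm_ge_zero])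
  then show ?thesis using sin_ge_half[OF y] by simp
qed

text \<open>Reversing one edge changes the sign of the cosine, so the exterior angle is the angle
  between the two successive directions.\<close>

lemma exterior_angle_le:
  assumes "x \<noteq> y" "y \<noteq> z"
  shows "pi - vertex_angle x y z \<le> 2 * norm (sgn (y - x) - sgn (z - y))"
proof -
  let ?u = "sgn (y - x)" and ?v = "sgn (z - y)"
  have uv: "norm ?u = 1" "norm ?v = 1" using assms by (auto simp: norm_sgn)
  have "\<bar>?u \<bullet> ?v\<bar> \<le> 1" using Cauchy_Schwarz_ineq2[of ?u ?v] uv by simp
  moreover have "((x - y) \<bullet> (z - y)) / (norm (x - y) * norm (z - y)) = - (?u \<bullet> ?v)"
  proof -
    have "x - y = - (y - x)" by simp
    then show ?thesis
      by (simp only: inner_minus_left norm_minus_cancel) (simp add: sgn_div_norm divide_inverse mult_ac)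
  qed
  ultimately have "pi - vertex_angle x y z = arccos (?u \<bullet> ?v)"
    unfolding vertex_angle_def by (simp add: arccos_minus)
  then show ?thesis using arccos_inner_le[OF uv] by simp
qed

lemma sum_by_parts_inner:
  fixes u z :: "nat \<Rightarrow> 'a::real_inner"
  assumes "1 \<le> n"
  shows "(\<Sum>i = 1..<n. (u (i - 1) - u i) \<bullet> z i) =
    (\<Sum>i<n. u i \<bullet> (z (Suc i) - z i)) + u 0 \<bullet> z 0 - u (n - 1) \<bullet> z n"
  using assms
proof (induction n rule: nat_induct_at_least)
  case (Suc n)
  then show ?case by (simp add: inner_diff)
qed (simp add: inner_diff)

section \<open>Shortest paths are polygonal\<close>

text \<open>Replace the arc between the parameters \<open>a\<close> and \<open>b\<close> by the
  segment. The competitor agrees with \<open>g\<close> elsewhere, and the common lengths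
  cancel.\<close>

lemma length_on_shortest_le_dist:
  fixes g :: "real \<Rightarrow> 'a::real_normed_vector"
  assumes g: "shortest_path_on S g" "path_length g < \<infinity>"
    and ab: "0 \<le> a" "a \<le> b" "b \<le> 1"
    and S: "closed_segment (g a) (g b) \<subseteq> S"
  shows "length_on a b g \<le> dist (g a) (g b)"
proof -
  have split: "path_length f = length_on 0 a f + (length_on a b f + length_on b 1 f)"
    for f :: "real \<Rightarrow> 'a"
    unfolding path_length_eq using ab by (simp flip: length_on_combine)
  note nonneg = length_on_nonneg[of 0 a g] length_on_nonneg[of a b g] length_on_nonneg[of b 1 g]
  \<comment> \<open>Finite total length makes all three summands real, as the cancellation
    requires.\<close>
  from g(2) obtain A M C where AMC: "length_on 0 a g = ereal A" "length_on a b g = ereal M"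
    "length_on b 1 g = ereal C"
    unfolding split using nonneg
    by (cases "length_on 0 a g"; cases "length_on a b g"; cases "length_on b 1 g") auto
  show ?thesis
  \<comment> \<open>The rescaling \<open>\<phi>\<close> divides by \<open>b - a\<close>; for
    \<open>a = b\<close> additivity gives \<open>M = M + M\<close>, hence length 0.\<close>
  proof (cases "a = b")
    case True
    then have "M = M + M" using length_on_combine[of a a a g] AMC(2) by simp
    then show ?thesis using AMC(2) True by simp
  next
    case False
    then have less: "a < b" using ab by simp
    define \<phi> where "\<phi> = (\<lambda>t. (t - a) / (b - a))"
    define h where "h = (\<lambda>t. if t \<in> {a..b} then linepath (g a) (g b) (\<phi> t) else g t)"
    have \<phi>: "continuous_on {a..b} \<phi>" "mono_on {a..b} \<phi>" "\<phi> a = 0" "\<phi> b = 1"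
      using less by (auto simp: \<phi>_def divide_right_mono intro!: continuous_intros mono_onI)
    have \<phi>01: "\<phi> t \<in> {0..1}" if "t \<in> {a..b}" for t
      using mono_onD[OF \<phi>(2), of a t] mono_onD[OF \<phi>(2), of t b] that \<phi>(3,4) by auto
    have h: "h t = g t" if "t \<in> {0..a} \<union> {b..1}" for t
      using that less \<phi>(3,4) by (auto simp: h_def linepath_def)
    have contg: "continuous_on {0..1} g" and gS: "g ` {0..1} \<subseteq> S"
      using g(1) by (auto simp: shortest_path_on_def path_def path_image_def)
    have "continuous_on ({0..a} \<union> {a..b} \<union> {b..1}) h"
    proof (intro continuous_on_closed_Un)
      show "continuous_on {0..a} h"
        using ab h by (intro continuous_on_eq[OF continuous_on_subset[OF contg]]) auto
      show "continuous_on {b..1} h"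
        using ab h by (intro continuous_on_eq[OF continuous_on_subset[OF contg]]) auto
      have "continuous_on {a..b} (\<lambda>t. linepath (g a) (g b) (\<phi> t))"
        unfolding linepath_def by (intro continuous_intros \<phi>)
      then show "continuous_on {a..b} h" by (rule continuous_on_eq) (simp add: h_def)
    qed auto
    moreover have "{0..a} \<union> {a..b} \<union> {b..1} = {0..1}" using ab by auto
    ultimately have "path h" by (simp add: path_def)
    moreover have "path_image h \<subseteq> S"
    proof -
      have "h t \<in> S" if "t \<in> {0..1}" for t
        using that gS S \<phi>01[of t] linepath_in_path[of "\<phi> t" "g a" "g b"] by (auto simp: h_def)
      then show ?thesis by (auto simp: path_image_def)
    qed
    moreover have "pathstart h = pathstart g" "pathfinish h = pathfinish g"
      using ab by (auto simp: pathstart_def pathfinish_def h)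
    ultimately have "path_length g \<le> path_length h"
      using g(1) by (simp add: shortest_path_on_def)
    moreover have "length_on 0 a h = length_on 0 a g" "length_on b 1 h = length_on b 1 g"
      by (auto intro!: length_on_cong h)
    moreover have "length_on a b h = length_on a b (linepath (g a) (g b) \<circ> \<phi>)"
      by (rule length_on_cong) (simp add: h_def)
    moreover have "\<dots> = dist (g a) (g b)"
      using length_on_reparam[OF ab(2) \<phi>(1,2), of "linepath (g a) (g b)"] \<phi>(3,4)
      by (simp add: path_length_linepath flip: path_length_eq)
    ultimately show ?thesis unfolding split by (simp add: AMC)
  qed
qed

text \<open>Equality in the triangle inequality puts \<open>g t\<close> on the segment, at the
  fraction \<open>dist (g a) (g t) / dist (g a) (g b)\<close>. Chains with two intermediate points
  show that this fraction is monotone.\<close>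

lemma length_on_le_dist_imp_linear:
  fixes g :: "real \<Rightarrow> 'a::euclidean_space"
  assumes "a < b" "continuous_on {a..b} g" and le: "length_on a b g \<le> dist (g a) (g b)"
  obtains \<phi> where "continuous_on {a..b} \<phi>" "mono_on {a..b} \<phi>" "\<phi> a = (0::real)" "\<phi> b = 1"
    "\<And>t. t \<in> {a..b} \<Longrightarrow> g t = linepath (g a) (g b) (\<phi> t)"
proof -
  let ?d = "dist (g a) (g b)"
  have chain: "dist (g a) (g s) + dist (g s) (g t) + dist (g t) (g b) \<le> ?d"
    if "a \<le> s" "s \<le> t" "t \<le> b" for s t
    using order_trans[OF chain_length_le_length_on[of "[a, s, t, b]" a b g] le] that
    by (simp add: add.assoc)
  show ?thesis
  \<comment> \<open>If the ends coincide, \<open>g\<close> is constant on the interval and the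
    fraction is undefined; an affine parameter is used instead.\<close>
  proof (cases "g a = g b")
    case True
    have "g t = linepath (g a) (g b) ((t - a) / (b - a))" if "t \<in> {a..b}" for t
    proof -
      have "dist (g a) (g t) \<le> 0"
        using chain[of t t] that True by (smt (verit) atLeastAtMost_iff dist_self zero_le_dist)
      then show ?thesis using True by (simp add: linepath_def)
    qed
    moreover have "continuous_on {a..b} (\<lambda>t. (t - a) / (b - a))"
      "mono_on {a..b} (\<lambda>t. (t - a) / (b - a))" "(a - a) / (b - a) = 0" "(b - a) / (b - a) = 1"
      using assms(1) by (auto simp: divide_right_mono intro!: continuous_intros mono_onI)
    ultimately show ?thesis by (intro that) (assumption | fact)+
  next
    case False
    then have d: "?d > 0" by simp
    let ?\<phi> = "\<lambda>t. dist (g a) (g t) / ?d"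
    have "g t = linepath (g a) (g b) (?\<phi> t)" if "t \<in> {a..b}" for t
    proof -
      have "?d = dist (g a) (g t) + dist (g t) (g b)"
        using chain[of t t] that dist_triangle[of "g a" "g b" "g t"] by simp
      then have "g t \<in> closed_segment (g a) (g b)"
        using between between_mem_segment by blast
      then obtain u where u: "0 \<le> u" "g t = linepath (g a) (g b) u"
        by (auto simp: in_segment linepath_def)
      then have "g a - g t = u *\<^sub>R (g a - g b)" by (simp add: linepath_def algebra_simps)
      then have "dist (g a) (g t) = u * ?d" using u(1) by (simp add: dist_norm)
      then show ?thesis using u(2) d by simp
    qed
    moreover have "mono_on {a..b} ?\<phi>"
    proof (rule mono_onI)
      fix s t
      assume st: "s \<in> {a..b}" "t \<in> {a..b}" "s \<le> t"
      then have "dist (g a) (g s) \<le> dist (g a) (g t)"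
        using chain[of s t] dist_triangle[of "g a" "g b" "g t"] zero_le_dist[of "g s" "g t"]
        by (simp del: zero_le_dist)
      then show "?\<phi> s \<le> ?\<phi> t" using d by (simp add: divide_right_mono)
    qed
    moreover have "continuous_on {a..b} ?\<phi>"
      using d by (intro continuous_intros assms(2)) auto
    moreover have "dist (g a) (g a) / ?d = 0" "?d / ?d = 1" using d by simp_all
    ultimately show ?thesis by (intro that) (assumption | fact)+
  qed
qed

section \<open>Gluing polygonal pieces\<close>

text \<open>\<open>is_polygonal_path\<close> over an arbitrary parameter interval; on
  \<open>{0..1}\<close> the two notions coincide.\<close>

definition polygonal_on :: "'a::real_normed_vector list \<Rightarrow> real \<Rightarrow> real \<Rightarrow> (real \<Rightarrow> 'a) \<Rightarrow> bool" where
  "polygonal_on zs a b g \<longleftrightarrow> zs \<noteq> [] \<and> distinct_adj zs \<and>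
    (\<exists>\<phi>. continuous_on {a..b} \<phi> \<and> mono_on {a..b} \<phi> \<and> \<phi> a = (0::real) \<and> \<phi> b = 1 \<and>
      (\<forall>t\<in>{a..b}. g t = polypath zs (\<phi> t)))"

lemma polygonal_onI:
  assumes "zs \<noteq> []" "distinct_adj zs" "continuous_on {a..b} \<phi> \<and> mono_on {a..b} \<phi>"
    "\<phi> a = (0::real)" "\<phi> b = 1" "\<And>t. t \<in> {a..b} \<Longrightarrow> g t = polypath zs (\<phi> t)"
  shows "polygonal_on zs a b g"
  using assms unfolding polygonal_on_def by blast

lemma continuous_mono_on_glue:
  fixes \<phi> \<psi> :: "real \<Rightarrow> real"
  assumes "a \<le> b" "b \<le> c" "\<phi> b = \<psi> b"
    and "continuous_on {a..b} \<phi>" "continuous_on {b..c} \<psi>"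
    and "mono_on {a..b} \<phi>" "mono_on {b..c} \<psi>"
  shows "continuous_on {a..c} (\<lambda>t. if t \<le> b then \<phi> t else \<psi> t) \<and>
    mono_on {a..c} (\<lambda>t. if t \<le> b then \<phi> t else \<psi> t)"
proof
  have "{t \<in> {a..c}. t \<le> b} = {a..b}" "{t \<in> {a..c}. b \<le> t} = {b..c}" using assms by auto
  then show "continuous_on {a..c} (\<lambda>t. if t \<le> b then \<phi> t else \<psi> t)"
    using assms by (intro continuous_on_cases_le) auto
  show "mono_on {a..c} (\<lambda>t. if t \<le> b then \<phi> t else \<psi> t)"
  proof (rule mono_onI)
    fix s t
    assume "s \<in> {a..c}" "t \<in> {a..c}" "s \<le> t"
    then show "(if s \<le> b then \<phi> s else \<psi> s) \<le> (if t \<le> b then \<phi> t else \<psi> t)"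
      using assms(3) mono_onD[OF assms(6), of s t] mono_onD[OF assms(7), of s t]
        mono_onD[OF assms(6), of s b] mono_onD[OF assms(7), of b t] by auto
  qed
qed

text \<open>Three cases, since repeated vertices are forbidden and \<open>polypath\<close> treats
  short lists separately: a constant first piece becomes a pause at parameter 0, a constant rest a
  pause at parameter 1, and otherwise each part takes half of the parameter interval.\<close>

lemma polygonal_on_Cons:
  fixes g :: "real \<Rightarrow> 'a::real_normed_vector"
  assumes ab: "a < b" "b < c"
    and \<phi>: "continuous_on {a..b} \<phi>" "mono_on {a..b} \<phi>" "\<phi> a = 0" "\<phi> b = 1"
      "\<And>t. t \<in> {a..b} \<Longrightarrow> g t = linepath (g a) (g b) (\<phi> t)"
    and zs: "polygonal_on zs b c g"
  shows "\<exists>zs. polygonal_on zs a c g"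
proof -
  from zs obtain \<psi> where ne: "zs \<noteq> []" "distinct_adj zs"
    and \<psi>: "continuous_on {b..c} \<psi>" "mono_on {b..c} \<psi>" "\<psi> b = 0" "\<psi> c = 1"
      "\<And>t. t \<in> {b..c} \<Longrightarrow> g t = polypath zs (\<psi> t)"
    unfolding polygonal_on_def by auto
  have start: "polypath zs 0 = hd zs" using polypath_path[OF ne(1)] by (simp add: pathstart_def)
  then have hd: "hd zs = g b" using \<psi>(3) \<psi>(5)[of b] ab by simp
  consider "g a = g b" | "g a \<noteq> g b" "zs = [g b]" | z' zs' where "g a \<noteq> g b" "zs = g b # z' # zs'"
    using hd ne(1) by (cases zs rule: polypath.cases) auto
  then show ?thesis
  proof cases
    case 1
    let ?\<chi> = "\<lambda>t. if t \<le> b then 0 else \<psi> t"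
    have "polygonal_on zs a c g"
    proof (rule polygonal_onI[of _ _ _ ?\<chi>])
      show "continuous_on {a..c} ?\<chi> \<and> mono_on {a..c} ?\<chi>"
        using ab \<psi>(1-3) by (intro continuous_mono_on_glue) (auto intro: mono_onI)
      show "g t = polypath zs (?\<chi> t)" if "t \<in> {a..c}" for t
        using that \<phi>(5)[of t] \<psi>(5)[of t] 1 hd start
        by (auto simp: linepath_def simp flip: scaleR_left_distrib)
    qed (use ab ne \<psi>(4) in auto)
    then show ?thesis by blast
  next
    case 2
    let ?\<chi> = "\<lambda>t. if t \<le> b then \<phi> t else 1"
    have "polygonal_on [g a, g b] a c g"
    proof (rule polygonal_onI[of _ _ _ ?\<chi>])
      show "continuous_on {a..c} ?\<chi> \<and> mono_on {a..c} ?\<chi>"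
        using ab \<phi>(1,2,4) by (intro continuous_mono_on_glue) (auto intro: mono_onI)
      show "g t = polypath [g a, g b] (?\<chi> t)" if "t \<in> {a..c}" for t
      proof (cases "t \<le> b")
        case True
        then have "g t = linepath (g a) (g b) (\<phi> t)" using that by (intro \<phi>(5)) simp
        then show ?thesis using True by simp
      next
        case False
        then have "g t = polypath [g b] (\<psi> t)" using that \<psi>(5)[of t] 2(2) by simp
        then show ?thesis using False by (simp add: linepath_def)
      qed
    qed (use ab 2(1) \<phi>(3) in auto)
    then show ?thesis by blast
  next
    case 3
    let ?\<chi> = "\<lambda>t. if t \<le> b then \<phi> t / 2 else (1 + \<psi> t) / 2"
    have "mono_on {a..b} (\<lambda>t. \<phi> t / 2)" "mono_on {b..c} (\<lambda>t. (1 + \<psi> t) / 2)"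
      using \<phi>(2) \<psi>(2) by (auto simp: mono_on_def)
    then have "continuous_on {a..c} ?\<chi> \<and> mono_on {a..c} ?\<chi>"
      using ab \<phi>(1,4) \<psi>(1,3) by (intro continuous_mono_on_glue) (auto intro!: continuous_intros)
    moreover have "g t = polypath (g a # zs) (?\<chi> t)" if t: "t \<in> {a..c}" for t
    proof (cases "t \<le> b")
      case True
      have "\<phi> t \<le> 1" using mono_onD[OF \<phi>(2), of t b] t True \<phi>(4) by auto
      then have "polypath (g a # zs) (?\<chi> t) = linepath (g a) (g b) (\<phi> t)"
        using True 3(2) by (simp add: joinpaths_def)
      then show ?thesis using \<phi>(5)[of t] t True by simp
    next
      case False
      have nonneg: "0 \<le> \<psi> t" using mono_onD[OF \<psi>(2), of b t] t False \<psi>(3) by auto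
      have "polypath (g a # zs) (?\<chi> t) = polypath zs (\<psi> t)"
      \<comment> \<open>Then the combined parameter is exactly \<open>1/2\<close>, where the join
        still evaluates its first piece; both pieces have the value \<open>g b\<close>
        there.\<close>
      proof (cases "\<psi> t = 0")
        case True
        then show ?thesis using False 3(2) start hd by (simp add: joinpaths_def linepath_def)
      next
        case neq: False
        then have "\<not> (1 + \<psi> t) / 2 \<le> 1 / 2" using nonneg by simp
        then show ?thesis using False 3(2) by (simp add: joinpaths_def add_divide_distrib)
      qed
      then show ?thesis using \<psi>(5)[of t] t False by simp
    qed
    moreover have "distinct_adj (g a # zs)" "?\<chi> a = 0" "?\<chi> c = 1"
      using ab 3 ne \<phi>(3) \<psi>(4) by auto
    ultimately have "polygonal_on (g a # zs) a c g"
      by (intro polygonal_onI[of _ _ _ ?\<chi>]) blast+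
    then show ?thesis by blast
  qed
qed

text \<open>Between the first and the last time in a convex piece \<open>F\<close> of \<open>S\<close> a shortest path follows a
  segment; after the last time it only meets the other pieces.\<close>
lemma shortest_path_polygonal_on:
  fixes g :: "real \<Rightarrow> 'a::euclidean_space"
  assumes g: "shortest_path_on S g" "path_length g < \<infinity>"
    and "finite \<F>" "0 \<le> a" "a < 1" "g ` {a..1} \<subseteq> \<Union>\<F>"
    and "\<And>F. F \<in> \<F> \<Longrightarrow> closed F \<and> convex F \<and> F \<subseteq> S"
  shows "\<exists>zs. polygonal_on zs a 1 g"
  using assms(3-)
proof (induction \<F> arbitrary: a rule: finite_psubset_induct)
  case (psubset \<F>)
  have cont: "continuous_on {s..1} g" if "0 \<le> s" for s
    using g(1) that continuous_on_subset[of "{0..1}" g "{s..1}"]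
    by (auto simp: shortest_path_on_def path_def)
  obtain F where F: "F \<in> \<F>" "g a \<in> F" using psubset.prems(2,3) by force
  have F': "closed F" "convex F" "F \<subseteq> S" using psubset.prems(4)[OF F(1)] by auto
  have "closed ({a..1} \<inter> g -` F)"
    using continuous_closed_preimage[OF cont[OF psubset.prems(1)] _ F'(1)] by simp
  \<comment> \<open>Compactness provides the last time \<open>b\<close> at which the path is in
    \<open>F\<close>.\<close>
  then have "compact ({a..1} \<inter> g -` F)"
    by (meson bounded_Int bounded_closed_interval compact_eq_bounded_closed)
  moreover have "{a..1} \<inter> g -` F \<noteq> {}" using F(2) psubset.prems(2) by force
  ultimately obtain b where "b \<in> {a..1} \<inter> g -` F" "\<And>t. t \<in> {a..1} \<inter> g -` F \<Longrightarrow> t \<le> b"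
    using compact_attains_sup[of "{a..1} \<inter> g -` F"] by blast
  then have b: "b \<in> {a..1}" "g b \<in> F" "\<And>t. t \<in> {a..1} \<Longrightarrow> g t \<in> F \<Longrightarrow> t \<le> b"
    by auto
  have seg: "\<exists>\<phi>. continuous_on {a..b} \<phi> \<and> mono_on {a..b} \<phi> \<and> \<phi> a = (0::real) \<and> \<phi> b = 1 \<and>
      (\<forall>t\<in>{a..b}. g t = linepath (g a) (g b) (\<phi> t))" if "a < b"
  proof -
    have "closed_segment (g a) (g b) \<subseteq> S"
      using closed_segment_subset[OF F(2) b(2) F'(2)] F'(3) by blast
    then have "length_on a b g \<le> dist (g a) (g b)"
      using b(1) psubset.prems(1) by (intro length_on_shortest_le_dist[OF g]) auto
    moreover have "continuous_on {a..b} g"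
      using continuous_on_subset[OF cont[OF psubset.prems(1)]] b(1) by auto
    ultimately show ?thesis using length_on_le_dist_imp_linear[OF that] by metis
  qed
  show ?case
  proof (cases "b = 1")
    case True
    then obtain \<phi> where \<phi>: "continuous_on {a..1} \<phi>" "mono_on {a..1} \<phi>" "\<phi> a = (0::real)" "\<phi> 1 = 1"
      "\<And>t. t \<in> {a..1} \<Longrightarrow> g t = linepath (g a) (g 1) (\<phi> t)"
      using seg psubset.prems(2) unfolding True by blast
    let ?zs = "if g a = g 1 then [g a] else [g a, g 1]"
    have "polygonal_on ?zs a 1 g"
    proof (rule polygonal_onI[of _ _ _ \<phi>])
      show "g t = polypath ?zs (\<phi> t)" if "t \<in> {a..1}" for t
        using \<phi>(5)[OF that] by (cases "g a = g 1") simp_all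
    qed (use \<phi>(1-4) in auto)
    then show ?thesis by blast
  next
    case False
    then have b1: "b < 1" "0 \<le> b" using b(1) psubset.prems(1) by auto
    have "g ` {b<..1} \<subseteq> \<Union>(\<F> - {F})"
    proof
      fix x
      assume "x \<in> g ` {b<..1}"
      then obtain t where t: "b < t" "t \<le> 1" "x = g t" by auto
      then have "t \<in> {a..1}" using b(1) by simp
      then have "g t \<in> \<Union>\<F>" "g t \<in> F \<Longrightarrow> t \<le> b" using psubset.prems(3) b(3) by blast+
      then show "x \<in> \<Union>(\<F> - {F})" using t by auto
    qed
    \<comment> \<open>At time \<open>b\<close> itself the path is in \<open>F\<close>. The union of
      the other pieces is closed, so it also contains \<open>g b\<close>, and the induction
      hypothesis applies from \<open>b\<close> on.\<close>
    moreover have "closed (\<Union>(\<F> - {F}))"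
      using psubset.hyps psubset.prems(4) by (intro closed_Union) simp_all
    moreover have "closure {b<..1} = {b..1}" using b1(1) by simp
    ultimately have "g ` {b..1} \<subseteq> \<Union>(\<F> - {F})"
      using image_closure_subset[of "{b<..1}" g "\<Union>(\<F> - {F})"] cont[OF b1(2)] by simp
    then obtain zs where zs: "polygonal_on zs b 1 g"
      using psubset.IH[of "\<F> - {F}" b] F(1) b1 psubset.prems(4) by blast
    show ?thesis
    proof (cases "a = b")
      case False
      then have "a < b" using b(1) by auto
      with seg obtain \<phi> where "continuous_on {a..b} \<phi>" "mono_on {a..b} \<phi>" "\<phi> a = (0::real)"
        "\<phi> b = 1" "\<And>t. t \<in> {a..b} \<Longrightarrow> g t = linepath (g a) (g b) (\<phi> t)" by blast
      from polygonal_on_Cons[OF \<open>a < b\<close> b1(1) this zs] show ?thesis .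
    qed (use zs in blast)
  qed
qed

lemma shortest_frontier_path_polygonal:
  fixes Q :: "'a::euclidean_space set"
  assumes Q: "polytope Q" "interior Q \<noteq> {}"
    and g: "shortest_path_on (frontier Q) g" "path_length g < \<infinity>"
  shows "\<exists>zs. is_polygonal_path zs g"
proof -
  \<comment> \<open>The facets are the finite family of closed convex pieces required above.\<close>
  have fr: "frontier Q = \<Union>{F. F facet_of Q}"
    using rel_frontier_of_polyhedron[OF polytope_imp_polyhedron[OF Q(1)]]
    by (simp add: rel_frontier_nonempty_interior Q(2))
  have "\<exists>zs. polygonal_on zs 0 1 g"
  proof (rule shortest_path_polygonal_on[OF g, of "{F. F facet_of Q}"])
    show "finite {F. F facet_of Q}" by (rule finite_polytope_facets[OF Q(1)])
    show "g ` {0..1} \<subseteq> \<Union>{F. F facet_of Q}"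
      using g(1) unfolding fr shortest_path_on_def path_image_def by simp
    fix F
    assume "F \<in> {F. F facet_of Q}"
    then have "F face_of Q" "F \<subseteq> frontier Q" unfolding fr by (auto simp: facet_of_def)
    then show "closed F \<and> convex F \<and> F \<subseteq> frontier Q"
      using face_of_polytope_polytope[OF Q(1)] polytope_imp_closed polytope_imp_convex by blast
  qed auto
  then show ?thesis unfolding polygonal_on_def is_polygonal_path_def .
qed

section \<open>Total curvature\<close>

lemma inner_sgn_self: "v \<bullet> sgn v = norm v" for v :: "'a::real_inner"
  by (cases "v = 0") (simp_all add: sgn_div_norm dot_square_norm power2_eq_square)

text \<open>Replacing \<open>y\<close> alone changes only the two edges at \<open>y\<close>, so
  minimality of \<open>g\<close> yields the local minimality used by the first variation.\<close>

lemma shortest_frontier_path_vertex: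
  fixes Q :: "'a::euclidean_space set"
  assumes Q: "convex Q" "closed Q" and r: "0 < r" "cball 0 r \<subseteq> Q"
    and g: "shortest_path_on (frontier Q) g"
    and zs: "is_polygonal_path zs g" "zs = ps @ x # y # z # qs"
  shows "r * norm (sgn (y - x) - sgn (z - y)) \<le> (sgn (y - x) - sgn (z - y)) \<bullet> y"
proof -
  let ?w = "sgn (y - x) - sgn (z - y)"
  note ne = cball_subset_imp_interior_nonempty[OF r]
  note props = polygonal_path_props[OF zs(1)]
  have "path_image (polypath zs) \<subseteq> frontier Q"
    using g props(2) by (simp add: shortest_path_on_def)
  then have succ: "successively (\<lambda>x y. closed_segment x y \<subseteq> frontier Q) zs"
    using zs by (subst (asm) path_image_polypath_subset_iff) auto
  have dist: "x \<noteq> y" "y \<noteq> z"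
    using zs by (auto simp: is_polygonal_path_def distinct_adj_append_iff)
  have seg: "closed_segment x y \<subseteq> frontier Q" "closed_segment y z \<subseteq> frontier Q"
    using succ unfolding zs(2) by (auto simp: successively_append_iff)
  have triple: "chain_length (ps @ x # y' # z # qs) =
      chain_length (ps @ [x]) + (dist x y' + dist y' z) + chain_length (z # qs)" for y'
    by (subst chain_length_append) simp
  have min: "dist x y + dist y z \<le> dist x y' + dist y' z"
    if y': "closed_segment x y' \<subseteq> - interior Q" "closed_segment y' z \<subseteq> - interior Q" for y'
  proof -
    have "successively (\<lambda>x y. closed_segment x y \<subseteq> - interior Q) zs"
      using succ by (rule successively_mono) (auto simp: frontier_def)
    then have "successively (\<lambda>x y. closed_segment x y \<subseteq> - interior Q) (ps @ x # y' # z # qs)"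
      using y' unfolding zs(2) by (auto simp: successively_append_iff)
    then have "path_length g \<le> chain_length (ps @ x # y' # z # qs)"
      using props(3,4) zs(2)
      by (intro shortest_frontier_path_le_chain[OF Q ne g]) (auto simp: hd_append)
    then show ?thesis
      unfolding props(1) unfolding zs(2) triple by simp
  qed
  show ?thesis
  proof (cases "?w = 0")
    case False
    let ?q = "r *\<^sub>R sgn ?w"
    \<comment> \<open>Among the points of the ball of radius \<open>r\<close>, this one has the
      largest inner product with \<open>?w\<close>, namely \<open>r * norm ?w\<close>.\<close>
    have "?q \<in> Q" using r False by (auto simp: norm_sgn subset_iff)
    then have "0 \<le> ?w \<bullet> (y - ?q)"
      using first_variation_frontier[OF Q ne dist seg min] by blast
    then show ?thesis by (simp only: inner_diff_right inner_scaleR_right inner_sgn_self)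
  qed simp
qed

text \<open>After summation by parts each edge is paired with its own direction and contributes its
  length; only two boundary terms remain.\<close>

lemma sum_norm_turns_le:
  fixes Q :: "'a::euclidean_space set"
  assumes Q: "convex Q" "closed Q" and r: "0 < r" "cball 0 r \<subseteq> Q" "Q \<subseteq> cball 0 1"
    and g: "shortest_path_on (frontier Q) g" and zs: "is_polygonal_path zs g" "2 \<le> length zs"
  shows "r * (\<Sum>i = 1..<length zs - 1.
      norm (sgn (zs ! i - zs ! (i - 1)) - sgn (zs ! Suc i - zs ! i))) \<le> chain_length zs + 2"
proof -
  define n where "n = length zs - 1"
  define u where "u i = sgn (zs ! Suc i - zs ! i)" for i
  have n: "1 \<le> n" using zs(2) by (simp add: n_def)
  have "r * norm (u (i - 1) - u i) \<le> (u (i - 1) - u i) \<bullet> zs ! i" if i: "i \<in> {1..<n}" for i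
  proof -
    obtain j where j: "i = Suc j" "Suc (Suc j) < length zs" using i by (cases i) (auto simp: n_def)
    then have "zs = take j zs @ zs ! j # zs ! Suc j # zs ! Suc (Suc j) # drop (Suc (Suc (Suc j))) zs"
      by (simp add: Cons_nth_drop_Suc)
    from shortest_frontier_path_vertex[OF Q r(1,2) g zs(1) this] show ?thesis
      by (simp add: u_def j(1))
  qed
  then have "r * (\<Sum>i = 1..<n. norm (u (i - 1) - u i)) \<le> (\<Sum>i = 1..<n. (u (i - 1) - u i) \<bullet> zs ! i)"
    unfolding sum_distrib_left by (intro sum_mono)
  also have "\<dots> = (\<Sum>i<n. u i \<bullet> (zs ! Suc i - zs ! i)) + u 0 \<bullet> zs ! 0 - u (n - 1) \<bullet> zs ! n"
    by (rule sum_by_parts_inner[OF n])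
  also have "(\<Sum>i<n. u i \<bullet> (zs ! Suc i - zs ! i)) = chain_length zs"
    unfolding sum_dist_eq_chain_length[symmetric] n_def[symmetric]
  proof (rule sum.cong)
    fix i
    show "u i \<bullet> (zs ! Suc i - zs ! i) = dist (zs ! i) (zs ! Suc i)"
      by (simp add: u_def inner_commute[of "sgn _"] inner_sgn_self dist_norm
          norm_minus_commute[of "zs ! i"])
  qed simp
  also have "\<dots> + u 0 \<bullet> zs ! 0 - u (n - 1) \<bullet> zs ! n \<le> chain_length zs + 2"
  proof -
    \<comment> \<open>The path runs in the unit ball and directions have norm at most 1, so each
      boundary term costs at most 1.\<close>
    have le: "\<bar>u i \<bullet> v\<bar> \<le> 1" if "v \<in> path_image g" for i v
    proof -
      have "v \<in> Q"
        using that g frontier_subset_closed[OF Q(2)] unfolding shortest_path_on_def by blast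
      then have "norm v \<le> 1" using r(3) by auto
      moreover have "norm (u i) \<le> 1" by (simp add: u_def norm_sgn)
      ultimately have "norm (u i) * norm v \<le> 1" by (simp add: mult_le_one)
      then show ?thesis using Cauchy_Schwarz_ineq2[of "u i" v] by linarith
    qed
    have "zs \<noteq> []" using zs(2) by auto
    then have "zs ! 0 \<in> path_image g" "zs ! n \<in> path_image g"
      using polygonal_path_props(3,4)[OF zs(1)] pathstart_in_path_image[of g]
        pathfinish_in_path_image[of g] by (simp_all add: hd_conv_nth last_conv_nth n_def)
    from this[THEN le, of 0] this[THEN le, of "n - 1"] show ?thesis by linarith
  qed
  finally show ?thesis
    by (simp add: u_def n_def cong: sum.cong_simp)
qed

text \<open>Compare \<open>sin (pi / 6) = 1/2\<close> with its argument.\<close>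

lemma three_le_pi: "3 \<le> pi"
  using sin_x_le_x[of "pi / 6"] by (simp add: sin_30)

theorem total_curvature_shortest_frontier_path_less:
  fixes Q :: "'a::euclidean_space set"
  assumes dim: "2 \<le> DIM('a)" and Q: "convex Q" "closed Q"
    and r: "0 < r" "cball 0 r \<subseteq> Q" "Q \<subseteq> cball 0 1"
    and g: "shortest_path_on (frontier Q) g" and zs: "is_polygonal_path zs g"
  shows "total_curvature zs < 4 * pi\<^sup>2 / r\<^sup>2"
proof (cases "2 \<le> length zs")
  \<comment> \<open>With at most one vertex the curvature sum is empty, and the bound is
    positive.\<close>
  case False
  then show ?thesis using r(1) by (simp add: total_curvature_def)
next
  case True
  let ?w = "\<lambda>i. norm (sgn (zs ! i - zs ! (i - 1)) - sgn (zs ! Suc i - zs ! i))"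
  have adj: "zs ! i \<noteq> zs ! Suc i" if "Suc i < length zs" for i
    using zs that by (simp add: is_polygonal_path_def distinct_adj_conv_nth)
  have "total_curvature zs \<le> (\<Sum>i = 1..<length zs - 1. 2 * ?w i)"
    unfolding total_curvature_def
  proof (rule sum_mono)
    fix i
    assume i: "i \<in> {1..<length zs - 1}"
    show "pi - vertex_angle (zs ! (i - 1)) (zs ! i) (zs ! Suc i) \<le> 2 * ?w i"
    proof -
      obtain j where "i = Suc j" "Suc (Suc j) < length zs" using i by (cases i) auto
      then show ?thesis using adj[of j] adj[of "Suc j"] by (simp add: exterior_angle_le)
    qed
  qed
  then have "r * total_curvature zs \<le> r * (2 * (\<Sum>i = 1..<length zs - 1. ?w i))"
    using r(1) by (intro mult_left_mono) (auto simp: sum_distrib_left)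
  also have "\<dots> \<le> 2 * (chain_length zs + 2)"
    using sum_norm_turns_le[OF Q r g zs True] by simp
  \<comment> \<open>The length is at most 6, and \<open>2 * (6 + 2) = 16\<close>.\<close>
  also have "\<dots> \<le> 16"
    using shortest_frontier_path_length_le[OF dim Q r g] polygonal_path_props(1)[OF zs] by simp
  finally have "r * total_curvature zs \<le> 16" .
  have "cball (0::'a) r \<subseteq> cball 0 1" using r by blast
  then have "r \<le> 1" using r(1) by (simp add: cball_subset_cball_iff)
  \<comment> \<open>The bound \<open>16 / r\<close> is weakened to \<open>16 / r\<^sup>2\<close> by
    \<open>r \<le> 1\<close>; then \<open>3 \<le> pi\<close> gives
    \<open>16 < 36 \<le> 4 * pi\<^sup>2\<close>.\<close>
  have "r * (r * total_curvature zs) \<le> 1 * 16"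
  proof -
    have "r * (r * total_curvature zs) \<le> r * 16"
      using \<open>r * total_curvature zs \<le> 16\<close> r(1) by (intro mult_left_mono) auto
    then show ?thesis using \<open>r \<le> 1\<close> by simp
  qed
  also have "\<dots> < 4 * pi\<^sup>2" using power_mono[OF three_le_pi, of 2] by simp
  finally show ?thesis using r(1) by (simp add: pos_less_divide_eq power2_eq_square mult_ac)
qed

text \<open>The existence clause keeps the bound from being vacuous. The bound ranges over all
  vertex lists because collinear vertices may be inserted.\<close>

theorem theorem1:
  fixes Q :: "(real ^ 3) set" and r :: real and g :: "real \<Rightarrow> real ^ 3"
  assumes "r > 0"
    and "polytope Q"
    and "cball 0 r \<subseteq> Q"
    and "Q \<subseteq> cball 0 1"
    and "shortest_path_on (frontier Q) g"
  shows "(\<exists>zs. is_polygonal_path zs g) \<and>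
         (\<forall>zs. is_polygonal_path zs g \<longrightarrow> total_curvature zs < 4 * pi\<^sup>2 / r\<^sup>2)"
proof -
  have Q: "convex Q" "closed Q"
    using assms(2) by (simp_all add: polytope_imp_convex polytope_imp_closed)
  have dim: "2 \<le> DIM(real ^ 3)" by simp
  note ne = cball_subset_imp_interior_nonempty[OF assms(1,3)]
  \<comment> \<open>Finiteness comes from the detour, before \<open>g\<close> is known to be
    polygonal.\<close>
  have "path_length g < \<infinity>"
    using shortest_frontier_path_length_le[OF dim Q assms(1,3,4,5)] by auto
  then show ?thesis
    using shortest_frontier_path_polygonal[OF assms(2) ne assms(5)]
      total_curvature_shortest_frontier_path_less[OF dim Q assms(1,3,4,5)] by blast
qed

end
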